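(* Let $V\in\mathbb{R}^{n\times r}$ be the projection matrix, with $V^{\mathrm T}V=I_r$, used to form the reduced model (by one-sided projection, i.e. with left projection matrix equal to $V$) of the discrete time-delay system described in the context. If $V$ satisfies $$\operatorname{colspan}\{V\}=\operatorname{colspan}\{\mathcal{X},\,x(0),\,x(-1),\dots,x(-d)\},$$ where $\mathcal X\in\mathbb{R}^{n\times N}$ is the discrete Walsh coefficient matrix of the original system, then the reduced model matches the first $N$ discrete Walsh coefficients of the output of the original system. That is, if the outputs of the original system and of the reduced model have the truncated expansions $y(k)\approx YW(k)$ and $\hat y(k)\approx\hat YW(k)$, respectively, with $Y,\hat Y\in\mathbb{R}^{p\times N}$, then $Y=\hat Y$.
   Context: **Discrete Walsh functions.** Let $l$ be a positive integer and $N=2^l$. For $0\le i,k\le N-1$ write $i=(i_{l-1}\cdots i_0)_2$ and $k=(k_{l-1}\cdots k_0)_2$ in binary. Put $g_0(i)=i_{l-1}$, $g_1(i)=i_{l-1}+i_{l-2}$, ..., $g_{l-1}(i)=i_1+i_0$, and $$W_i(k)=(-1)^{\sum_{j=0}^{l-1}g_j(i)k_j}.$$ The discrete Walsh vector is $W(k)=[W_0(k),\dots,W_{N-1}(k)]^{\mathrm T}$. A bounded signal sequence $z(k)$, $k=0,\dots,N-1$, is expanded as $z(k)=\sum_{i=0}^{N-1}z_iW_i(k)=ZW(k)$ with coefficient matrix $Z=[z_0\ z_1\ \cdots\ z_{N-1}]$, $z_i=\frac1N\sum_{k=0}^{N-1}z(k)W_i(k)$. The Walsh shift matrix $R\in\mathbb{R}^{N\times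 N}$ is $$R=\tfrac1N\,[W(N-1)\ W(0)\ \cdots\ W(N-2)]\,[W(0)\ W(1)\ \cdots\ W(N-1)],$$ so that $RW(0)=W(N-1)$ and $RW(k+1)=W(k)$ for $0\le k\le N-2$. The operational matrix for summation $S\in\mathbb{R}^{N\times N}$ has $(i+1,j+1)$ entry $$\tfrac1N\sum_{k=0}^{N-1}\sum_{q=0}^{k}W_i(q)W_j(k),\qquad 0\le i,j\le N-1,$$ so that $\sum_{i=0}^kW(i)=SW(k)$. **Original system.** The discrete time-delay system is $$x(t+1)=A_0x(t)+A_1x(t-d)+Bu(t),\qquad y(t)=Cx(t),\qquad t=0,1,2,\dots,$$ with constant real matrices $A_0,A_1\in\mathbb{R}^{n\times n}$, $B\in\mathbb{R}^{n\times m}$, $C\in\mathbb{R}^{p\times n}$, integer time delay $d$ with $N>d$, input $u(t)\in\mathbb{R}^m$, and given bounded non-zero initial values $x(j)\in\mathbb{R}^n$, $j=-d,\dots,0$. The input has the truncated expansion $u(i)\approx UW(i)$ with $U\in\mathbb{R}^{m\times N}$. **Walsh coefficient matrix of the original system.** The discrete Walsh coefficient matrix $\mathcal X\in\mathbb{R}^{n\times N}$ is that of the truncated expansion $x(i+1)\approx\mathcal XW(i)$ of the state. With $Q_j=[x(j)\ 0\ \cdots\ 0]\in\mathbb{R}^{n\times N}$ (so $x(j)=Q_jW(N-1)$) for $j=-d,\dots,0$, it is calculated from the linear matrix equation $$\mathcal{X}S=A_0Q_0+A_0\mathcal{X}RS-A_0\mathcal{X}+A_1\sum_{i=0}^{d}Q_{i-d}+A_1\mathcal{X}R^{d+1}S-A_1\sum_{i=0}^{d}\mathcal{X}R^{N+d-i}+BUS.$$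 **Reduced model.** The reduced model is $$\hat x(t+1)=\hat A_0\hat x(t)+\hat A_1\hat x(t-d)+\hat Bu(t),\qquad \hat y(t)=\hat C\hat x(t),\qquad t=0,1,2,\dots,$$ with state $\hat x(t)\in\mathbb{R}^r$, the same input $u$, coefficient matrices $\hat A_0=V^{\mathrm T}A_0V$, $\hat A_1=V^{\mathrm T}A_1V$, $\hat B=V^{\mathrm T}B$, $\hat C=CV$, and initial values $\hat x(j)=V^{\mathrm T}x(j)$ for $j=-d,\dots,0$.
   Formalization: X is taken to be the exact Walsh coefficient matrix of the state sequence x(k+1), k=0,…,N−1; the linear matrix equation from which X is said to be calculated is not used, since its solution generally differs from that matrix and the claim then fails. *)

theory Defs
  imports "Jordan_Normal_Form.VS_Connect"
begin

definition binary_digit :: "nat \<Rightarrow> nat \<Rightarrow> nat" where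
  "binary_digit i j = of_bool (bit i j)"

definition walsh_g :: "nat \<Rightarrow> nat \<Rightarrow> nat \<Rightarrow> nat" where
  "walsh_g l j i =
     (if j = 0 then binary_digit i (l - 1)
      else binary_digit i (l - j) + binary_digit i (l - j - 1))"

definition walsh :: "nat \<Rightarrow> nat \<Rightarrow> nat \<Rightarrow> real" where
  "walsh l i k = (-1) ^ (\<Sum>j<l. walsh_g l j i * binary_digit k j)"

text \<open>The $q \times 2^l$ matrix of the first $2^l$ Walsh coefficients of a signal in $\mathbf{R}^q$;
  only the samples at times $0, \dots, 2^l - 1$ enter.\<close>

definition walsh_coeff_mat :: "nat \<Rightarrow> nat \<Rightarrow> (nat \<Rightarrow> real vec) \<Rightarrow> real mat" where
  "walsh_coeff_mat l q z =
     mat q (2 ^ l) (\<lambda>(a, i). 1 / 2 ^ l * (\<Sum>k<2 ^ l. (z k $ a) * walsh l i k))"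

text \<open>The state is indexed by integers because the initial values sit at times $-d, \dots, 0$.\<close>

definition delay_system ::
  "nat \<Rightarrow> real mat \<Rightarrow> real mat \<Rightarrow> real mat \<Rightarrow> real mat \<Rightarrow>
   (nat \<Rightarrow> real vec) \<Rightarrow> (int \<Rightarrow> real vec) \<Rightarrow> (nat \<Rightarrow> real vec) \<Rightarrow> bool" where
  "delay_system d A0 A1 B C u x y \<longleftrightarrow>
     (\<forall>t. x (int t + 1) = A0 *\<^sub>v x (int t) + A1 *\<^sub>v x (int t - int d) + B *\<^sub>v u t) \<and>
     (\<forall>t. y t = C *\<^sub>v x (int t))"

abbreviation vec_span :: "nat \<Rightarrow> real vec set \<Rightarrow> real vec set" where
  "vec_span n S \<equiv> LinearCombinations.module.span class_ring (module_vec TYPE(real) n) S"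

end

theory Submission
  imports Defs
begin

text \<open>
  A truncated Walsh expansion with \<open>N = 2 ^ l\<close> terms loses nothing on the times
  \<open>0, \<dots>, N - 1\<close>: the Walsh vectors \<open>W(0), \<dots>, W(N - 1)\<close> are orthogonal
  (\<open>walsh_vectors_orthogonal\<close>), so the samples of a signal are recovered from its coefficient
  matrix as \<open>z(k) = Z W(k)\<close> (\<open>walsh_expansion\<close>).  Hence each state \<open>x(1), \<dots>, x(N)\<close>
  is a linear combination of the columns of \<open>X\<close>.  Together with the hypothesis on the initial
  values, the whole trajectory on \<open>-d, \<dots>, N\<close> lies in the column space of \<open>V\<close>.

  On that space \<open>V V\<^sup>T\<close> acts as the identity because \<open>V\<close> has orthonormal columns
  (\<open>projection_fixes_span_cols\<close>).  Multiplying the state equation by \<open>V\<^sup>T\<close> and inserting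
  \<open>V V\<^sup>T\<close> before the states turns it into the recursion of the reduced model, so
  \<open>x_hat(t) = V\<^sup>T x(t)\<close> as long as the trajectory stays in the column space
  (\<open>reduced_state_eq\<close>).  Then \<open>y_hat(t) = C V V\<^sup>T x(t) = C x(t) = y(t)\<close> on the times
  that enter the first \<open>N\<close> Walsh coefficients.
\<close>

section \<open>Orthogonality of the Walsh vectors\<close>

lemma sum_lessThan_double:
  fixes h :: "nat \<Rightarrow> 'a :: comm_monoid_add"
  shows "(\<Sum>i<2 * n. h i) = (\<Sum>i<n. h (2 * i) + h (2 * i + 1))"
  by (induction n) (simp_all add: add.assoc)

text \<open>
  The distributive law: the numbers below \<open>2 ^ l\<close> are the choices of one bit for each position,
  so they enumerate the terms of the expanded product.
\<close>

lemma sum_prod_bits: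
  fixes f :: "nat \<Rightarrow> bool \<Rightarrow> 'a :: comm_semiring_1"
  shows "(\<Sum>i<2 ^ l. \<Prod>b<l. f b (bit (i :: nat) b)) = (\<Prod>b<l. f b False + f b True)"
proof (induction l arbitrary: f)
  case 0
  then show ?case by simp
next
  case (Suc l)
  have even: "(\<Prod>b<Suc l. f b (bit (2 * i) b)) =
      f 0 False * (\<Prod>b<l. f (Suc b) (bit i b))" for i :: nat
    by (simp add: prod.lessThan_Suc_shift bit_0 bit_Suc del: prod.lessThan_Suc)
  have odd: "(\<Prod>b<Suc l. f b (bit (2 * i + 1) b)) =
      f 0 True * (\<Prod>b<l. f (Suc b) (bit i b))" for i :: nat
    by (simp add: prod.lessThan_Suc_shift bit_0 bit_Suc del: prod.lessThan_Suc)
  have "(\<Sum>i<2 ^ Suc l. \<Prod>b<Suc l. f b (bit (i :: nat) b)) =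
      (\<Sum>i<2 ^ l. (f 0 False + f 0 True) * (\<Prod>b<l. f (Suc b) (bit (i :: nat) b)))"
    unfolding power_Suc sum_lessThan_double even odd by (simp add: distrib_right)
  also have "\<dots> = (f 0 False + f 0 True) * (\<Prod>b<l. f (Suc b) False + f (Suc b) True)"
    using Suc.IH[of "\<lambda>b. f (Suc b)"] by (simp add: sum_distrib_left[symmetric])
  also have "\<dots> = (\<Prod>b<Suc l. f b False + f b True)"
    by (simp add: prod.lessThan_Suc_shift del: prod.lessThan_Suc)
  finally show ?case .
qed

lemma not_bit_of_less_power:
  assumes "k < 2 ^ l" and "l \<le> j"
  shows "\<not> bit (k :: nat) j"
proof -
  have "k < 2 ^ j"
    using assms by (meson less_le_trans one_le_numeral power_increasing)
  then show ?thesis by (simp add: bit_iff_odd)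
qed

text \<open>
  Summation by parts moves the Gray-code sum from the digits of the function index \<open>i\<close> to those of
  the time \<open>k\<close>.  The exponent then is a sum of independent terms, one for each digit of \<open>i\<close>, which
  exhibits \<open>W\<^sub>i(k)\<close> as a character in \<open>i\<close>.
\<close>

lemma walsh_exponent_by_parts:
  assumes "k < 2 ^ l"
  shows "(\<Sum>j<l. walsh_g l j i * binary_digit k j) =
    (\<Sum>j<l. binary_digit i (l - Suc j) * (binary_digit k j + binary_digit k (Suc j)))"
proof (cases l)
  case 0
  then show ?thesis by simp
next
  case (Suc l')
  \<comment> \<open>The shifted sum has no term at the top digit; completing it to \<open>j < l\<close> adds this zero.\<close>
  have top: "binary_digit k (Suc l') = 0"
    using not_bit_of_less_power[OF assms, of "Suc l'"] Suc by (simp add: binary_digit_def)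
  let ?g = "\<lambda>b. binary_digit i b" and ?k = "\<lambda>j. binary_digit k j"
  have "(\<Sum>j<Suc l'. walsh_g (Suc l') j i * ?k j) =
      ?g l' * ?k 0 + (\<Sum>j<l'. (?g (l' - j) + ?g (l' - Suc j)) * ?k (Suc j))"
    by (subst sum.lessThan_Suc_shift) (simp add: walsh_g_def)
  also have "\<dots> = (?g l' * ?k 0 + (\<Sum>j<l'. ?g (l' - Suc j) * ?k (Suc j))) +
      (\<Sum>j<l'. ?g (l' - j) * ?k (Suc j))"
    by (simp add: distrib_right sum.distrib)
  also have "?g l' * ?k 0 + (\<Sum>j<l'. ?g (l' - Suc j) * ?k (Suc j)) =
      (\<Sum>j<Suc l'. ?g (l' - j) * ?k j)"
    by (subst sum.lessThan_Suc_shift) simp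
  also have "(\<Sum>j<l'. ?g (l' - j) * ?k (Suc j)) = (\<Sum>j<Suc l'. ?g (l' - j) * ?k (Suc j))"
    by (simp add: top)
  finally show ?thesis
    unfolding Suc by (simp add: distrib_left sum.distrib)
qed

lemma walsh_product_eq_prod:
  assumes "k < 2 ^ l" and "q < 2 ^ l"
  shows "walsh l i k * walsh l i q =
    (\<Prod>b<l. (-1) ^ (binary_digit i b *
      (binary_digit k (l - Suc b) + binary_digit k (Suc (l - Suc b)) +
       (binary_digit q (l - Suc b) + binary_digit q (Suc (l - Suc b))))))"
proof -
  let ?c = "\<lambda>j. binary_digit k j + binary_digit k (Suc j) +
    (binary_digit q j + binary_digit q (Suc j))"
  have "walsh l i k * walsh l i q =
      (-1) ^ (\<Sum>j<l. binary_digit i (l - Suc j) * ?c j)"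
    unfolding walsh_def walsh_exponent_by_parts[OF assms(1)] walsh_exponent_by_parts[OF assms(2)]
    by (simp only: power_add[symmetric] sum.distrib[symmetric] distrib_left[symmetric])
  also have "\<dots> = (\<Prod>j<l. (-1) ^ (binary_digit i (l - Suc j) * ?c j))"
    by (simp add: power_sum)
  also have "\<dots> = (\<Prod>b<l. (-1) ^ (binary_digit i b * ?c (l - Suc b)))"
    by (subst prod.nat_diff_reindex[symmetric]) (auto intro!: prod.cong)
  finally show ?thesis .
qed

text \<open>
  A nontrivial character sums to zero.  The character in \<open>i\<close> attached to \<open>k \<noteq> q\<close> is nontrivial at
  the digit that meets the highest bit where \<open>k\<close> and \<open>q\<close> differ: there the next higher bits agree
  and cancel modulo two.
\<close>

lemma walsh_vectors_orthogonal:
  assumes k: "k < 2 ^ l" and q: "q < 2 ^ l"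
  shows "(\<Sum>i<2 ^ l. walsh l i k * walsh l i q) = (if k = q then 2 ^ l else 0)"
proof -
  define c where "c j = binary_digit k j + binary_digit k (Suc j) +
    (binary_digit q j + binary_digit q (Suc j))" for j
  have "(\<Sum>i<2 ^ l. walsh l i k * walsh l i q) =
      (\<Sum>i<2 ^ l. \<Prod>b<l. (-1) ^ (of_bool (bit (i :: nat) b) * c (l - Suc b)))"
    by (simp only: walsh_product_eq_prod[OF assms] c_def binary_digit_def)
  also have "\<dots> = (\<Prod>b<l. 1 + (-1) ^ c (l - Suc b))"
    using sum_prod_bits[where f = "\<lambda>b e. (-1) ^ (of_bool e * c (l - Suc b))" and l = l] by simp
  also have "\<dots> = (\<Prod>j<l. 1 + (-1) ^ c j)"
    by (rule prod.nat_diff_reindex)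
  also have "\<dots> = (if k = q then 2 ^ l else (0 :: real))"
  proof (cases "k = q")
    case True
    then have "even (c j)" for j
      by (simp add: c_def)
    then show ?thesis using True by simp
  next
    case False
    define D where "D = {j. bit k j \<noteq> bit q j}"
    have D_sub: "D \<subseteq> {..<l}"
      unfolding D_def using not_bit_of_less_power[OF k] not_bit_of_less_power[OF q]
      by (auto simp: not_less[symmetric])
    then have fin: "finite D" using finite_subset by blast
    have "D \<noteq> {}" using False unfolding D_def by (auto simp: bit_eq_iff)
    then have "Max D \<in> D" using fin by simp
    moreover have "Suc (Max D) \<notin> D" using Max_ge[OF fin] not_less_eq_eq by blast
    ultimately have "odd (c (Max D))"
      by (auto simp: D_def c_def binary_digit_def)
    then have "1 + (-1) ^ c (Max D) = (0 :: real)" by simp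
    moreover have "Max D < l" using \<open>Max D \<in> D\<close> D_sub by auto
    ultimately have "(\<Prod>j<l. 1 + (-1) ^ c j) = (0 :: real)"
      by (intro prod_zero) auto
    then show ?thesis using False by simp
  qed
  finally show ?thesis .
qed

lemma walsh_expansion:
  assumes z: "z k \<in> carrier_vec q" and k: "k < 2 ^ l"
  shows "walsh_coeff_mat l q z *\<^sub>v vec (2 ^ l) (\<lambda>i. walsh l i k) = z k"
proof (rule eq_vecI)
  show "dim_vec (walsh_coeff_mat l q z *\<^sub>v vec (2 ^ l) (\<lambda>i. walsh l i k)) = dim_vec (z k)"
    using z by (simp add: walsh_coeff_mat_def)
next
  fix a assume "a < dim_vec (z k)"
  then have a: "a < q" using z by simp
  have "(walsh_coeff_mat l q z *\<^sub>v vec (2 ^ l) (\<lambda>i. walsh l i k)) $ a =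
      (\<Sum>i<2 ^ l. 1 / 2 ^ l * (\<Sum>k'<2 ^ l. (z k' $ a) * walsh l i k') * walsh l i k)"
    using a by (simp add: walsh_coeff_mat_def scalar_prod_def lessThan_atLeast0)
  also have "\<dots> = 1 / 2 ^ l *
      (\<Sum>i<2 ^ l. \<Sum>k'<2 ^ l. (z k' $ a) * (walsh l i k' * walsh l i k))"
    by (simp add: sum_distrib_left sum_distrib_right mult_ac)
  also have "\<dots> = 1 / 2 ^ l *
      (\<Sum>k'<2 ^ l. (z k' $ a) * (\<Sum>i<2 ^ l. walsh l i k' * walsh l i k))"
    by (subst sum.swap) (simp add: sum_distrib_left)
  also have "\<dots> = 1 / 2 ^ l * (\<Sum>k'<2 ^ l. if k' = k then (z k' $ a) * 2 ^ l else 0)"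
    using k by (intro arg_cong[where f = "(*) _"] sum.cong)
      (simp_all add: walsh_vectors_orthogonal)
  also have "\<dots> = z k $ a"
    using k by simp
  finally show "(walsh_coeff_mat l q z *\<^sub>v vec (2 ^ l) (\<lambda>i. walsh l i k)) $ a = z k $ a" .
qed

section \<open>Orthonormal projection of the system\<close>

lemma mult_mat_vec_in_span_cols:
  fixes M :: "real mat"
  assumes "M \<in> carrier_mat n c" and "w \<in> carrier_vec c"
  shows "M *\<^sub>v w \<in> vec_span n (set (cols M))"
proof -
  interpret vec_space "TYPE(real)" n .
  have "M *\<^sub>v w \<in> col_space M"
    using assms by (auto simp: col_space_eq)
  then show ?thesis by (simp add: col_space_def)
qed

lemma projection_fixes_span_cols:
  fixes V :: "real mat"
  assumes V: "V \<in> carrier_mat n r" and orth: "V\<^sup>T * V = 1\<^sub>m r"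
    and v: "v \<in> vec_span n (set (cols V))"
  shows "V *\<^sub>v (V\<^sup>T *\<^sub>v v) = v"
proof -
  interpret vec_space "TYPE(real)" n .
  obtain w where w: "w \<in> carrier_vec r" and v_eq: "v = V *\<^sub>v w"
    using v V by (auto simp: col_space_eq[OF V] col_space_def[symmetric])
  have "V\<^sup>T *\<^sub>v (V *\<^sub>v w) = (V\<^sup>T * V) *\<^sub>v w"
    using V w by simp
  then show ?thesis using w by (simp add: v_eq orth)
qed

text \<open>
  Multiplying the state equation by \<open>V\<^sup>T\<close> gives the reduced equation except that the states
  appear as \<open>x(t)\<close> where the reduced one has \<open>V V\<^sup>T x(t)\<close>.  Computing the state at a time uses only
  strictly earlier states, so \<open>V V\<^sup>T\<close> has to fix those before \<open>T\<close> for the relation to reach \<open>T\<close>.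
\<close>

lemma reduced_state_eq:
  fixes A0 A1 B C V :: "real mat"
  assumes A0: "A0 \<in> carrier_mat n n" and A1: "A1 \<in> carrier_mat n n"
    and B: "B \<in> carrier_mat n m" and V: "V \<in> carrier_mat n r"
    and u: "\<And>t. u t \<in> carrier_vec m"
    and sys: "delay_system d A0 A1 B C u x y"
    and red: "delay_system d (V\<^sup>T * A0 * V) (V\<^sup>T * A1 * V) (V\<^sup>T * B) (C * V) u x_hat y_hat"
    and init: "\<And>j. j \<in> {- int d..0} \<Longrightarrow> x_hat j = V\<^sup>T *\<^sub>v x j"
    and carrier: "\<And>j. j \<in> {- int d..<int T} \<Longrightarrow> x j \<in> carrier_vec n"
    and fixed: "\<And>j. j \<in> {- int d..<int T} \<Longrightarrow> V *\<^sub>v (V\<^sup>T *\<^sub>v x j) = x j"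
    and j: "j \<in> {- int d..int T}"
  shows "x_hat j = V\<^sup>T *\<^sub>v x j"
proof -
  have "\<forall>j \<in> {- int d..int t}. x_hat j = V\<^sup>T *\<^sub>v x j" if "t \<le> T" for t
    using that
  proof (induction t)
    case 0
    then show ?case using init by simp
  next
    case (Suc t)
    then have IH: "\<And>j. j \<in> {- int d..int t} \<Longrightarrow> x_hat j = V\<^sup>T *\<^sub>v x j" by simp
    have state_term: "(V\<^sup>T * M * V) *\<^sub>v x_hat j = V\<^sup>T *\<^sub>v (M *\<^sub>v x j)"
      if M: "M \<in> carrier_mat n n" and j: "j \<in> {- int d..int t}" for M j
    proof -
      have jT: "j \<in> {- int d..<int T}" using j Suc.prems by auto
      note xj = carrier[OF jT]
      have w: "V\<^sup>T *\<^sub>v x j \<in> carrier_vec r" using V xj by simp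
      have "(V\<^sup>T * M * V) *\<^sub>v x_hat j = (V\<^sup>T * M) *\<^sub>v (V *\<^sub>v (V\<^sup>T *\<^sub>v x j))"
        unfolding IH[OF j] using V M w by (intro assoc_mult_mat_vec) auto
      also have "\<dots> = V\<^sup>T *\<^sub>v (M *\<^sub>v x j)"
        unfolding fixed[OF jT] using V M xj by (intro assoc_mult_mat_vec) auto
      finally show ?thesis .
    qed
    have x0: "x (int t) \<in> carrier_vec n" and xd: "x (int t - int d) \<in> carrier_vec n"
      using Suc.prems by (auto intro!: carrier)
    have "x_hat (int t + 1) = (V\<^sup>T * A0 * V) *\<^sub>v x_hat (int t)
        + (V\<^sup>T * A1 * V) *\<^sub>v x_hat (int t - int d) + (V\<^sup>T * B) *\<^sub>v u t"
      using red by (simp add: delay_system_def)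
    also have "\<dots> = V\<^sup>T *\<^sub>v (A0 *\<^sub>v x (int t)) + V\<^sup>T *\<^sub>v (A1 *\<^sub>v x (int t - int d))
        + V\<^sup>T *\<^sub>v (B *\<^sub>v u t)"
      using V B u[of t] by (simp add: state_term[OF A0] state_term[OF A1])
    also have "\<dots> = V\<^sup>T *\<^sub>v (A0 *\<^sub>v x (int t) + A1 *\<^sub>v x (int t - int d) + B *\<^sub>v u t)"
      using V A0 A1 B u[of t] x0 xd by (simp add: mult_add_distrib_mat_vec[of _ r n])
    also have "\<dots> = V\<^sup>T *\<^sub>v x (int t + 1)"
      using sys by (simp add: delay_system_def)
    finally have step: "x_hat (int t + 1) = V\<^sup>T *\<^sub>v x (int t + 1)" .
    show ?case
    proof
      fix j assume "j \<in> {- int d..int (Suc t)}"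
      then consider "j \<in> {- int d..int t}" | "j = int t + 1" by force
      then show "x_hat j = V\<^sup>T *\<^sub>v x j" using IH step by cases auto
    qed
  qed
  then show ?thesis using j by blast
qed

section \<open>Matching of the Walsh coefficients\<close>

theorem theorem1:
  fixes l n m p r d :: nat
    and A0 A1 B C V X Y Y_hat :: "real mat"
    and u y y_hat :: "nat \<Rightarrow> real vec"
    and x x_hat :: "int \<Rightarrow> real vec"
  assumes "l \<ge> 1" and "d < 2 ^ l"
    and "A0 \<in> carrier_mat n n" and "A1 \<in> carrier_mat n n"
    and "B \<in> carrier_mat n m" and "C \<in> carrier_mat p n"
    and "\<forall>t. u t \<in> carrier_vec m"
    and "\<forall>j \<in> {- int d..0}. x j \<in> carrier_vec n"
    and "\<exists>j \<in> {- int d..0}. x j \<noteq> 0\<^sub>v n"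
    and "delay_system d A0 A1 B C u x y"
    and "X = walsh_coeff_mat l n (\<lambda>k. x (int k + 1))"
    and "V \<in> carrier_mat n r" and "V\<^sup>T * V = 1\<^sub>m r"
    and "vec_span n (set (cols V)) = vec_span n (set (cols X) \<union> x ` {- int d..0})"
    and "\<forall>j \<in> {- int d..0}. x_hat j = V\<^sup>T *\<^sub>v x j"
    and "delay_system d (V\<^sup>T * A0 * V) (V\<^sup>T * A1 * V) (V\<^sup>T * B) (C * V) u x_hat y_hat"
    and "Y = walsh_coeff_mat l p y"
    and "Y_hat = walsh_coeff_mat l p y_hat"
  shows "Y = Y_hat"
proof -
  interpret vs: vec_space "TYPE(real)" n .
  note V = \<open>V \<in> carrier_mat n r\<close>
  have next_state: "x (int t + 1) \<in> carrier_vec n" for t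
  proof -
    have "x (int t + 1) = A0 *\<^sub>v x (int t) + A1 *\<^sub>v x (int t - int d) + B *\<^sub>v u t"
      using assms(10) unfolding delay_system_def by blast
    then have "dim_vec (x (int t + 1)) = n" using assms(5) by simp
    then show ?thesis by (rule carrier_vecI)
  qed
  have carrier: "x j \<in> carrier_vec n" if "- int d \<le> j" for j
  proof (cases "j \<le> 0")
    case True
    then show ?thesis using assms(8) that by simp
  next
    case False
    then have "j = int (nat (j - 1)) + 1" by simp
    then show ?thesis using next_state by metis
  qed
  have X: "X \<in> carrier_mat n (2 ^ l)"
    unfolding assms(11) by (simp add: walsh_coeff_mat_def)
  have generators: "set (cols X) \<union> x ` {- int d..0} \<subseteq> carrier_vec n"
    using X carrier cols_dim[of X] by auto
  have in_span: "x j \<in> vec_span n (set (cols V))" if j: "j \<in> {- int d..2 ^ l}" for j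
  proof (cases "j \<le> 0")
    case True
    then show ?thesis
      unfolding assms(14) using j generators by (intro vs.span_mem) auto
  next
    case False
    define k where "k = nat (j - 1)"
    have j_eq: "j = int k + 1" using False by (simp add: k_def)
    have "int k < 2 ^ l" using j unfolding j_eq atLeastAtMost_iff by linarith
    then have k: "k < 2 ^ l" by simp
    have "x j = X *\<^sub>v vec (2 ^ l) (\<lambda>i. walsh l i k)"
      unfolding assms(11) j_eq
      using walsh_expansion[of "\<lambda>k. x (int k + 1)", OF next_state k] by simp
    then have "x j \<in> vec_span n (set (cols X))"
      using mult_mat_vec_in_span_cols[OF X] by simp
    then show ?thesis
      unfolding assms(14) using vs.span_is_monotone[OF Un_upper1] by blast
  qed
  have fixed: "V *\<^sub>v (V\<^sup>T *\<^sub>v x j) = x j" if "j \<in> {- int d..2 ^ l}" for j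
    using projection_fixes_span_cols[OF V assms(13) in_span[OF that]] .
  have y_eq: "y_hat t = y t" if t: "t < 2 ^ l" for t
  proof -
    have range: "int t \<in> {- int d..2 ^ l}" using t by simp
    have "x_hat (int t) = V\<^sup>T *\<^sub>v x (int t)"
    proof (rule reduced_state_eq[OF assms(3-5) V _ assms(10,16), where T = "2 ^ l"])
      show "u s \<in> carrier_vec m" for s using assms(7) by blast
      show "x_hat j = V\<^sup>T *\<^sub>v x j" if "j \<in> {- int d..0}" for j
        using assms(15) that by blast
      show "x j \<in> carrier_vec n" if "j \<in> {- int d..<int (2 ^ l)}" for j
        using carrier that by simp
      show "V *\<^sub>v (V\<^sup>T *\<^sub>v x j) = x j" if "j \<in> {- int d..<int (2 ^ l)}" for j
        using that by (intro fixed) simp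
      show "int t \<in> {- int d..int (2 ^ l)}" using range by simp
    qed
    then have "y_hat t = (C * V) *\<^sub>v (V\<^sup>T *\<^sub>v x (int t))"
      using assms(16) by (simp add: delay_system_def)
    also have "\<dots> = C *\<^sub>v (V *\<^sub>v (V\<^sup>T *\<^sub>v x (int t)))"
      using assms(6) V carrier[of "int t"] by (intro assoc_mult_mat_vec) auto
    also have "\<dots> = y t"
      using fixed[OF range] assms(10) by (simp add: delay_system_def)
    finally show ?thesis .
  qed
  show ?thesis
    unfolding assms(17,18) walsh_coeff_mat_def using y_eq by (intro cong_mat) auto
qed

end
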